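(* Let $\mathcal{C}\subseteq\mathbb{R}^n$ be a nonempty polytope, let $f\colon\mathcal{C}\to\mathbb{R}$ be convex and differentiable in an open set containing $\mathcal{C}$, and suppose that $(\mathcal{C},f)$ has extended $L$-curvature for some $L>0$ and satisfies the $(\mu,\theta)$-error bound relative to the vertex distance $\mathfrak{v}$ for some $\mu>0$ and $\theta\in[0,1/2]$. Then the iterates $\mathbf{x}^{(t)}=\mathcal{V}\boldsymbol{\lambda}^{(t)}$, $t\in\mathbb{N}$, of the away-step Frank-Wolfe algorithm (AFW), and likewise those of the blended pairwise Frank-Wolfe algorithm (BPFW), with line-search or short-step satisfy the following convergence rates. (i) When $\theta=1/2$, for all $t\in\mathbb{N}$: $$f(\mathbf{x}^{(t)})-f^*\le(f(\mathbf{x}^{(0)})-f^* )\left(1-\min\left\{\frac{\mu}{8L},\frac12\right\}\right)^{\lceil t/2\rceil}.$$ (ii) When $\theta\in[0,1/2)$, for all $t\in\{0,1,\dots,t_0\}$: $$f(\mathbf{x}^{(t)})-f^*\le\frac{f(\mathbf{x}^{(0)})-f^*}{2^{\lceil t/2\rceil}},$$ where $t_0\in\mathbb{N}$ is the smallest $t$ such that $$\frac{\mu^{2\theta}(f(\mathbf{x}^{(t)})-f^* )^{1-2\theta}}{8L}\le\frac12.$$ For $t\in\mathbb{N}$ with $t_0<t\le t_1:=|S(\boldsymbol{\lambda}^{(t_0)})|+t_0-1$: $$f(\mathbf{x}^{(t)})-f^*\le f(\mathbf{x}^{(t_0)})-f^*.$$ Finally, for $t\in\mathbb{N}$ with $t>t_1$: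 $$f(\mathbf{x}^{(t)})-f^*\le\left((f(\mathbf{x}^{(t_1)})-f^* )^{2\theta-1}+\frac{(1-2\theta)\mu^{2\theta}}{8L}\cdot\left\lceil\frac{t-t_1}{2}\right\rceil\right)^{\frac{1}{2\theta-1}}.$$
   Context: $\mathbb{N}=\{0,1,2,\dots\}$. $f^*=\min_{\mathbf{x}\in\mathcal{C}}f(\mathbf{x})$ and $X^*=\{\mathbf{x}\in\mathcal{C}\mid f(\mathbf{x})=f^*\}$. Extended $L$-curvature: for all $\mathbf{x}\in\mathcal{C}$, $\mathbf{d}\in\mathcal{C}-\mathcal{C}$ and $\eta\ge0$ with $\mathbf{x}+\eta\mathbf{d}\in\mathcal{C}$, $f(\mathbf{x}+\eta\mathbf{d})\le f(\mathbf{x})+\eta\langle\nabla f(\mathbf{x}),\mathbf{d}\rangle+\frac{L\eta^2}{2}$. Vertex representations: $\mathcal{V}$ is the set of vertices of $\mathcal{C}$; $\Delta(\mathcal{V})=\{\boldsymbol{\lambda}=(\lambda_{\mathbf{v}})_{\mathbf{v}\in\mathcal{V}}\mid\lambda_{\mathbf{v}}\ge0,\ \sum_{\mathbf{v}}\lambda_{\mathbf{v}}=1\}$; $\mathcal{V}\boldsymbol{\lambda}=\sum_{\mathbf{v}\in\mathcal{V}}\lambda_{\mathbf{v}}\mathbf{v}$; $S(\boldsymbol{\lambda})=\{\mathbf{v}\in\mathcal{V}\mid\lambda_{\mathbf{v}}>0\}$; and for $\mathbf{x}\in\mathcal{C}$, $\mathbf{S}(\mathbf{x})=\{S(\boldsymbol{\lambda})\mid\mathbf{x}=\mathcal{V}\boldsymbol{\lambda}\text{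 for some }\boldsymbol{\lambda}\in\Delta(\mathcal{V})\}$. Vertex distance: $\mathfrak{v}\colon\mathcal{C}\times\mathcal{C}\to[0,1]$, $\mathfrak{v}(\mathbf{y},\mathbf{x})=\max_{S\in\mathbf{S}(\mathbf{x})}\min\{\gamma\ge0\mid\mathbf{y}-\mathbf{x}=\gamma(\mathbf{v}-\mathbf{u})\text{ for some }\mathbf{v}\in\mathcal{C}\text{ and }\mathbf{u}\in\mathrm{conv}(S)\}$. Error bound: for $\mathfrak{d}\colon\mathcal{C}\times\mathcal{C}\to[0,1]$, $\mu>0$, $\theta\in[0,1/2]$, $(\mathcal{C},f)$ satisfies the $(\mu,\theta)$-error bound relative to $\mathfrak{d}$ if for all $\mathbf{x}\in\mathcal{C}$, $\left(\frac{f(\mathbf{x})-f^*}{\mu}\right)^\theta\ge\min_{\mathbf{x}^*\in X^*}\mathfrak{d}(\mathbf{x}^*,\mathbf{x})$. Algorithms: start at a vertex $\mathbf{x}^{(0)}=\mathcal{V}\boldsymbol{\lambda}^{(0)}$ of $\mathcal{C}$ with $|S(\boldsymbol{\lambda}^{(0)})|=1$. At iteration $t\in\mathbb{N}$, write $\mathbf{x}=\mathbf{x}^{(t)}$, $\boldsymbol{\lambda}=\boldsymbol{\lambda}^{(t)}$, $S=S(\boldsymbol{\lambda})$, and choose $\mathbf{a}\in\arg\max_{\mathbf{y}\in S}\langle\nabla f(\mathbf{x}),\mathbf{y}\rangle$, $\mathbf{z}\in\arg\min_{\mathbf{y}\in S}\langle\nabla f(\mathbf{x}),\mathbf{y}\rangle$,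 and a vertex $\mathbf{v}\in\arg\min_{\mathbf{y}\in\mathcal{C}}\langle\nabla f(\mathbf{x}),\mathbf{y}\rangle$. Let $\mathbf{d}_{\mathrm{FW}}=\mathbf{v}-\mathbf{x}$, $\mathbf{d}_{\mathrm{AFW}}=\mathbf{x}-\mathbf{a}$, $\mathbf{d}_{\mathrm{BPFW}}=\mathbf{z}-\mathbf{a}$. Select $\mathbf{d}^{(t)}$ minimizing $\langle\nabla f(\mathbf{x}),\mathbf{d}\rangle$ over $\mathbf{d}\in\{\mathbf{d}_{\mathrm{FW}},\mathbf{d}_{\mathrm{AFW}}\}$ in AFW, or over $\mathbf{d}\in\{\mathbf{d}_{\mathrm{FW}},\mathbf{d}_{\mathrm{BPFW}}\}$ in BPFW. The maximum step-size $\eta_{t,\max}$ is $1$ if $\mathbf{d}^{(t)}=\mathbf{d}_{\mathrm{FW}}$, $\frac{\lambda_{\mathbf{a}}}{1-\lambda_{\mathbf{a}}}$ if $\mathbf{d}^{(t)}=\mathbf{d}_{\mathrm{AFW}}$ (read as $+\infty$ if $\lambda_{\mathbf{a}}=1$, in which case the direction is $\mathbf 0$), and $\lambda_{\mathbf{a}}$ if $\mathbf{d}^{(t)}=\mathbf{d}_{\mathrm{BPFW}}$. Choose $\eta=\eta_t\in[0,\eta_{t,\max}]$, set $\mathbf{x}^{(t+1)}=\mathbf{x}^{(t)}+\eta_t\mathbf{d}^{(t)}$ and $\boldsymbol{\lambda}^{(t+1)}=\boldsymbol{\lambda}^+$, where - if $\mathbf{d}^{(t)}=\mathbf{d}_{\mathrm{FW}}$: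 $\lambda^+_{\mathbf{v}}=(1-\eta)\lambda_{\mathbf{v}}+\eta$ and $\lambda^+_{\mathbf{s}}=(1-\eta)\lambda_{\mathbf{s}}$ for $\mathbf{s}\ne\mathbf{v}$; - if $\mathbf{d}^{(t)}=\mathbf{d}_{\mathrm{AFW}}$: $\lambda^+_{\mathbf{a}}=(1+\eta)\lambda_{\mathbf{a}}-\eta$ and $\lambda^+_{\mathbf{s}}=(1+\eta)\lambda_{\mathbf{s}}$ for $\mathbf{s}\ne\mathbf{a}$; - if $\mathbf{d}^{(t)}=\mathbf{d}_{\mathrm{BPFW}}$: $\lambda^+_{\mathbf{a}}=\lambda_{\mathbf{a}}-\eta$, $\lambda^+_{\mathbf{z}}=\lambda_{\mathbf{z}}+\eta$ and $\lambda^+_{\mathbf{s}}=\lambda_{\mathbf{s}}$ otherwise (and $\boldsymbol{\lambda}^+=\boldsymbol{\lambda}$ if $\mathbf{a}=\mathbf{z}$). Line-search: $\eta_t\in\arg\min_{\eta\in[0,\eta_{t,\max}]}f(\mathbf{x}^{(t)}+\eta\mathbf{d}^{(t)})$. Short-step: $\eta_t=\arg\min_{\eta\in[0,\eta_{t,\max}]}\{f(\mathbf{x}^{(t)})+\eta\langle\nabla f(\mathbf{x}^{(t)}),\mathbf{d}^{(t)}\rangle+\frac{L\eta^2}{2}\}$, where $L$ is the extended curvature constant. If $\eta_{t,\max}=+\infty$ the interval is $[0,\infty)$. *)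

theory Defs
  imports "HOL-Analysis.Analysis"
begin

definition gradient :: "('a::real_inner \<Rightarrow> real) \<Rightarrow> 'a \<Rightarrow> 'a" where
  "gradient f x = (THE D. GDERIV f x :> D)"

lemma gradient_gderiv:
  fixes f :: "'a::euclidean_space \<Rightarrow> real"
  assumes "f differentiable (at x)"
  shows "GDERIV f x :> gradient f x"
proof -
  obtain f' where f': "(f has_derivative f') (at x)"
    using assms by (auto simp: differentiable_def)
  have lin: "linear f'"
    using f' by (rule has_derivative_linear)
  have "f' h = h \<bullet> adjoint f' 1" for h
    using adjoint_works[OF lin, of h "1::real"] by (simp add: inner_commute)
  then have "f' = (\<lambda>h. h \<bullet> adjoint f' 1)"
    by (rule ext)
  then have D: "GDERIV f x :> adjoint f' 1"
    using f' unfolding gderiv_def by metis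
  moreover have "D = adjoint f' 1" if "GDERIV f x :> D" for D
  proof -
    have "(\<lambda>h. h \<bullet> D) = (\<lambda>h. h \<bullet> adjoint f' 1)"
      using that D unfolding gderiv_def by (rule has_derivative_unique)
    then show ?thesis
      by (metis vector_eq_ldot)
  qed
  ultimately show ?thesis
    unfolding gradient_def by (rule theI)
qed

definition min_value :: "'a set \<Rightarrow> ('a \<Rightarrow> real) \<Rightarrow> real" where
  "min_value C f = (INF x\<in>C. f x)"

definition minimizers :: "'a set \<Rightarrow> ('a \<Rightarrow> real) \<Rightarrow> 'a set" where
  "minimizers C f = {x \<in> C. f x = min_value C f}"

definition extended_curvature ::
  "'a::euclidean_space set \<Rightarrow> ('a \<Rightarrow> real) \<Rightarrow> real \<Rightarrow> bool" where
  "extended_curvature C f L \<longleftrightarrow>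
     (\<forall>x\<in>C. \<forall>d\<in>{y - z | y z. y \<in> C \<and> z \<in> C}. \<forall>\<eta>\<ge>0. x + \<eta> *\<^sub>R d \<in> C \<longrightarrow>
        f (x + \<eta> *\<^sub>R d) \<le> f x + \<eta> * (gradient f x \<bullet> d) + L * \<eta>\<^sup>2 / 2)"

definition vertices :: "'a::real_vector set \<Rightarrow> 'a set" where
  "vertices C = {v. v extreme_point_of C}"

text \<open>
  A family of weights indexed by the vertices is represented by a function on the whole
  space; its values outside the set of vertices are never used.
\<close>

definition vertex_weights :: "'a::real_vector set \<Rightarrow> ('a \<Rightarrow> real) set" where
  "vertex_weights C = {l. (\<forall>v\<in>vertices C. 0 \<le> l v) \<and> (\<Sum>v\<in>vertices C. l v) = 1}"

definition vertex_comb :: "'a::real_vector set \<Rightarrow> ('a \<Rightarrow> real) \<Rightarrow> 'a" where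
  "vertex_comb C l = (\<Sum>v\<in>vertices C. l v *\<^sub>R v)"

definition weight_support :: "'a::real_vector set \<Rightarrow> ('a \<Rightarrow> real) \<Rightarrow> 'a set" where
  "weight_support C l = {v \<in> vertices C. 0 < l v}"

definition supports :: "'a::real_vector set \<Rightarrow> 'a \<Rightarrow> 'a set set" where
  "supports C x = {weight_support C l | l. l \<in> vertex_weights C \<and> x = vertex_comb C l}"

text \<open>
  For a polytope \<open>C\<close> and \<open>x, y \<in> C\<close> the infimum below is attained, by compactness of \<open>C\<close> and of
  \<open>convex hull S\<close>, and the maximum ranges over a finite nonempty family.
\<close>

definition vertex_distance :: "'a::euclidean_space set \<Rightarrow> 'a \<Rightarrow> 'a \<Rightarrow> real" where
  "vertex_distance C y x =
     (MAX S\<in>supports C x.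
        Inf {\<gamma>. 0 \<le> \<gamma> \<and> (\<exists>v\<in>C. \<exists>u\<in>convex hull S. y - x = \<gamma> *\<^sub>R (v - u))})"

text \<open>
  Since \<open>0 powr 0 = 0\<close>, the case \<open>\<theta> = 0\<close> is separated in order to obtain the convention
  \<open>0\<^sup>0 = 1\<close>. For \<open>\<dd> = vertex_distance C\<close> the infimum over the minimizers is attained, because
  \<open>vertex_distance C\<close> is lower semicontinuous in its first argument on the polytope \<open>C\<close>.
\<close>

definition error_bound ::
  "'a set \<Rightarrow> ('a \<Rightarrow> real) \<Rightarrow> ('a \<Rightarrow> 'a \<Rightarrow> real) \<Rightarrow> real \<Rightarrow> real \<Rightarrow> bool" where
  "error_bound C f \<dd> \<mu> \<theta> \<longleftrightarrow>
     (\<forall>x\<in>C. (if \<theta> = 0 then 1 else ((f x - min_value C f) / \<mu>) powr \<theta>)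
              \<ge> (INF y\<in>minimizers C f. \<dd> y x))"

datatype variant = AFW | BPFW

datatype step_rule = Line_Search | Short_Step

text \<open>
  The kind of a step is recorded separately from its direction vector, so that the maximum
  step-size and the weight update are determined even if both candidate vectors coincide;
  ties may be broken arbitrarily.
\<close>

datatype step_kind = FW_Step | Away_Step | Pairwise_Step

fun step_kinds :: "variant \<Rightarrow> step_kind set" where
  "step_kinds AFW = {FW_Step, Away_Step}"
| "step_kinds BPFW = {FW_Step, Pairwise_Step}"

fun direction :: "'a::real_vector \<Rightarrow> 'a \<Rightarrow> 'a \<Rightarrow> 'a \<Rightarrow> step_kind \<Rightarrow> 'a" where
  "direction x v a z FW_Step = v - x"
| "direction x v a z Away_Step = x - a"
| "direction x v a z Pairwise_Step = z - a"

fun max_step :: "real \<Rightarrow> step_kind \<Rightarrow> ereal" where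
  "max_step la FW_Step = 1"
| "max_step la Away_Step = (if la = 1 then \<infinity> else ereal (la / (1 - la)))"
| "max_step la Pairwise_Step = ereal la"

fun update_weights ::
  "'a \<Rightarrow> 'a \<Rightarrow> 'a \<Rightarrow> real \<Rightarrow> ('a \<Rightarrow> real) \<Rightarrow> step_kind \<Rightarrow> 'a \<Rightarrow> real" where
  "update_weights v a z \<eta> l FW_Step =
     (\<lambda>s. if s = v then (1 - \<eta>) * l v + \<eta> else (1 - \<eta>) * l s)"
| "update_weights v a z \<eta> l Away_Step =
     (\<lambda>s. if s = a then (1 + \<eta>) * l a - \<eta> else (1 + \<eta>) * l s)"
| "update_weights v a z \<eta> l Pairwise_Step =
     (if a = z then l else l(a := l a - \<eta>, z := l z + \<eta>))"

fun step_objective ::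
  "('a::euclidean_space \<Rightarrow> real) \<Rightarrow> real \<Rightarrow> 'a \<Rightarrow> 'a \<Rightarrow> step_rule \<Rightarrow> real \<Rightarrow> real" where
  "step_objective f L x d Line_Search \<eta> = f (x + \<eta> *\<^sub>R d)"
| "step_objective f L x d Short_Step \<eta> = f x + \<eta> * (gradient f x \<bullet> d) + L * \<eta>\<^sup>2 / 2"

definition fw_step ::
  "variant \<Rightarrow> step_rule \<Rightarrow> 'a::euclidean_space set \<Rightarrow> ('a \<Rightarrow> real) \<Rightarrow> real \<Rightarrow>
   'a \<Rightarrow> ('a \<Rightarrow> real) \<Rightarrow> 'a \<Rightarrow> ('a \<Rightarrow> real) \<Rightarrow> bool" where
  "fw_step alg rule C f L x l x' l' \<longleftrightarrow>
     (\<exists>a z v k \<eta>.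
        is_arg_max (\<lambda>y. gradient f x \<bullet> y) (\<lambda>y. y \<in> weight_support C l) a \<and>
        is_arg_min (\<lambda>y. gradient f x \<bullet> y) (\<lambda>y. y \<in> weight_support C l) z \<and>
        v \<in> vertices C \<and> is_arg_min (\<lambda>y. gradient f x \<bullet> y) (\<lambda>y. y \<in> C) v \<and>
        is_arg_min (\<lambda>k. gradient f x \<bullet> direction x v a z k) (\<lambda>k. k \<in> step_kinds alg) k \<and>
        is_arg_min (step_objective f L x (direction x v a z k) rule)
          (\<lambda>\<eta>. 0 \<le> \<eta> \<and> ereal \<eta> \<le> max_step (l a) k) \<eta> \<and>
        x' = x + \<eta> *\<^sub>R direction x v a z k \<and>
        (\<forall>s\<in>vertices C. l' s = update_weights v a z \<eta> l k s))"

definition fw_run ::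
  "variant \<Rightarrow> step_rule \<Rightarrow> 'a::euclidean_space set \<Rightarrow> ('a \<Rightarrow> real) \<Rightarrow> real \<Rightarrow>
   (nat \<Rightarrow> 'a) \<Rightarrow> (nat \<Rightarrow> 'a \<Rightarrow> real) \<Rightarrow> bool" where
  "fw_run alg rule C f L x l \<longleftrightarrow>
     x 0 \<in> vertices C \<and> l 0 \<in> vertex_weights C \<and> x 0 = vertex_comb C (l 0) \<and>
     card (weight_support C (l 0)) = 1 \<and>
     (\<forall>t. fw_step alg rule C f L (x t) (l t) (x (Suc t)) (l (Suc t)))"

end

theory Submission
  imports Defs
begin

text \<open>
  Write \<open>h\<close> for the gap \<open>f x - min f\<close>, \<open>g = \<nabla>f(x) \<bullet> (a - v)\<close> for the largest linearized decrease between
  the support and the polytope, and \<open>r = - \<nabla>f(x) \<bullet> d\<close> for the slope of the chosen direction. Two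
  inequalities drive the proof. Convexity and the error bound relative to the vertex distance give
  \<open>h \<le> g (h / \<mu>)\<^sup>\<theta>\<close> (\<open>gap_le_error_bound\<close>), and the selection rule gives \<open>r \<ge> g / 2\<close>
  (\<open>away_gap_le_slope\<close>).

  By the curvature bound, if the step-size \<open>r / L\<close> does not exceed the maximum, then \<open>h\<close> decreases by
  at least \<open>r\<^sup>2 / (2 L) \<ge> g\<^sup>2 / (8 L)\<close>, that is, by at least the fraction \<open>rate L \<mu> \<theta> h\<close> of itself.
  Otherwise the maximum step-size is taken; for line search this rests on the observation that a step
  shorter than \<open>r / L\<close> is always the maximum one (\<open>slope_le_step\<close>). Then a Frank-Wolfe step at least
  halves \<open>h\<close>, and any other step does not increase \<open>h\<close> and drops a vertex from the support. Call a step
  productive if it decreases \<open>h\<close> by at least the fraction \<open>min (rate L \<mu> \<theta> h) (1/2)\<close>. Since the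
  support never becomes empty, and a step that is not productive shrinks it while a productive one
  adds at most one vertex, at least half of the steps are productive when one starts from a support
  with one element (\<open>half_of_steps_productive\<close>). For \<open>\<theta> = 1/2\<close> the rate is the constant \<open>\<mu> / (8 L)\<close> and the linear
  convergence follows.

  For \<open>\<theta> < 1/2\<close> the bound after \<open>t1\<close> starts from the gap at \<open>t1\<close>, and a large support at
  that time would allow many unproductive steps right after it. This does not happen, because the support at time \<open>t0\<close> is
  again a single vertex: from a single vertex, as long as the rate exceeds \<open>1/2\<close>, the algorithm
  takes a full Frank-Wolfe step to a vertex (\<open>full_step_from_vertex\<close>). Hence \<open>t1 = t0\<close>, every
  earlier step at least halves the gap, and the counting argument can be restarted at \<open>t0\<close>, where
  \<open>sublinear_step\<close> solves the recursion \<open>h' \<le> (1 - q h\<^sup>e) h\<close> with \<open>e = 1 - 2 \<theta>\<close>.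
\<close>

section \<open>Weights and first-order convexity\<close>

lemma vertex_weights_cong:
  assumes "\<And>s. s \<in> vertices C \<Longrightarrow> l s = l' s"
  shows "l \<in> vertex_weights C \<longleftrightarrow> l' \<in> vertex_weights C"
    and "vertex_comb C l = vertex_comb C l'"
    and "weight_support C l = weight_support C l'"
proof -
  have "(\<Sum>s\<in>vertices C. l s) = (\<Sum>s\<in>vertices C. l' s)"
    using assms by (rule sum.cong[OF refl])
  then show "l \<in> vertex_weights C \<longleftrightarrow> l' \<in> vertex_weights C"
    using assms by (simp add: vertex_weights_def)
  show "vertex_comb C l = vertex_comb C l'"
    unfolding vertex_comb_def using assms by (intro sum.cong refl) simp
  show "weight_support C l = weight_support C l'"
    unfolding weight_support_def using assms by (intro Collect_cong conj_cong refl) simp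
qed

text \<open>
  Each update is a scaling plus corrections at single vertices. In this form sums of updated
  weights split into known sums, and the pairwise step with \<open>a = z\<close> follows the same formula.
\<close>

lemma update_weights_eq:
  "update_weights v a z \<eta> l FW_Step s = (1 - \<eta>) * l s + (if s = v then \<eta> else 0)"
  "update_weights v a z \<eta> l Away_Step s = (1 + \<eta>) * l s - (if s = a then \<eta> else 0)"
  "update_weights v a z \<eta> l Pairwise_Step s
     = l s - (if s = a then \<eta> else 0) + (if s = z then \<eta> else 0)"
  by auto

lemma gradient_ineq:
  fixes f :: "'a::euclidean_space \<Rightarrow> real"
  assumes conv: "convex_on C f" and x: "x \<in> C" and y: "y \<in> C"
    and diff: "f differentiable (at x)"
  shows "f x + gradient f x \<bullet> (y - x) \<le> f y"
proof -
  let ?d = "y - x"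
  have "(f has_derivative (\<lambda>h. h \<bullet> gradient f x)) (at x)"
    using gradient_gderiv[OF diff] unfolding gderiv_def by simp
  then have "((\<lambda>t. f (x + t *\<^sub>R ?d)) has_derivative (\<lambda>t. (t *\<^sub>R ?d) \<bullet> gradient f x)) (at 0)"
    by (intro has_derivative_compose[where g = f and f = "\<lambda>t. x + t *\<^sub>R ?d"])
       (auto intro!: derivative_eq_intros)
  then have "((\<lambda>t. f (x + t *\<^sub>R ?d)) has_field_derivative (?d \<bullet> gradient f x)) (at 0)"
    by (simp add: has_field_derivative_def mult_commute_abs)
  then have "((\<lambda>t. (f (x + t *\<^sub>R ?d) - f x) / t) \<longlongrightarrow> ?d \<bullet> gradient f x) (at_right 0)"
    unfolding has_field_derivative_iff by (auto intro: tendsto_mono[OF at_le])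
  moreover have "\<forall>\<^sub>F t in at_right 0. (f (x + t *\<^sub>R ?d) - f x) / t \<le> f y - f x"
    unfolding eventually_at_right_field
  proof (intro exI[of _ 1] conjI allI impI)
    fix t :: real assume t: "0 < t" "t < 1"
    have "f ((1 - t) *\<^sub>R x + t *\<^sub>R y) \<le> (1 - t) * f x + t * f y"
      using t x y by (intro convex_onD[OF conv]) auto
    moreover have "(1 - t) *\<^sub>R x + t *\<^sub>R y = x + t *\<^sub>R ?d"
      by (simp add: algebra_simps)
    ultimately show "(f (x + t *\<^sub>R ?d) - f x) / t \<le> f y - f x"
      using t by (simp add: field_simps)
  qed simp
  ultimately have "?d \<bullet> gradient f x \<le> f y - f x"
    by (intro tendsto_upperbound) auto
  then show ?thesis by (simp add: inner_commute)
qed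

section \<open>Polytopes with bounded curvature\<close>

locale curved_polytope =
  fixes C :: "'a::euclidean_space set" and f :: "'a \<Rightarrow> real" and L :: real
  assumes polytope: "polytope C" and nonempty: "C \<noteq> {}"
    and convex_f: "convex_on C f"
    and differentiable: "\<And>x. x \<in> C \<Longrightarrow> f differentiable (at x)"
    and L_pos: "L > 0" and curvature: "extended_curvature C f L"
begin

abbreviation gap :: "'a \<Rightarrow> real" where
  "gap x \<equiv> f x - min_value C f"

lemma convex_C: "convex C"
  using polytope by (rule polytope_imp_convex)

lemma finite_vertices: "finite (vertices C)"
  unfolding vertices_def using polytope by (intro finite_polyhedron_extreme_points polytope_imp_polyhedron)

lemma vertices_subset: "vertices C \<subseteq> C"
  by (auto simp: vertices_def extreme_point_of_def)

lemma finite_support: "finite (weight_support C l)"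
  using finite_vertices by (simp add: weight_support_def)

lemma minimizers_nonempty: "minimizers C f \<noteq> {}"
  and min_value_le: "x \<in> C \<Longrightarrow> min_value C f \<le> f x"
proof -
  have "compact C" using polytope by (rule polytope_imp_compact)
  moreover have "continuous_on C f"
    using differentiable by (intro continuous_at_imp_continuous_on ballI
      differentiable_imp_continuous_within) auto
  ultimately obtain m where m: "m \<in> C" "\<And>y. y \<in> C \<Longrightarrow> f m \<le> f y"
    using continuous_attains_inf nonempty by metis
  then have "min_value C f = f m"
    unfolding min_value_def by (intro cInf_eq_minimum) auto
  then show "minimizers C f \<noteq> {}" and "x \<in> C \<Longrightarrow> min_value C f \<le> f x"
    using m by (auto simp: minimizers_def)
qed

lemma weight_le_1:
  assumes "l \<in> vertex_weights C" "s \<in> vertices C"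
  shows "l s \<le> 1"
proof -
  have "l s \<le> (\<Sum>s\<in>vertices C. l s)"
    using assms finite_vertices by (intro member_le_sum) (auto simp: vertex_weights_def)
  then show ?thesis using assms(1) by (simp add: vertex_weights_def)
qed

lemma sum_support:
  assumes "l \<in> vertex_weights C"
  shows "(\<Sum>s\<in>weight_support C l. l s) = 1"
    and "(\<Sum>s\<in>weight_support C l. l s *\<^sub>R s) = vertex_comb C l"
proof -
  have zero: "l s = 0" if "s \<in> vertices C - weight_support C l" for s
    using that assms by (force simp: weight_support_def vertex_weights_def)
  have "(\<Sum>s\<in>weight_support C l. l s) = (\<Sum>s\<in>vertices C. l s)"
    using zero finite_vertices
    by (intro sum.mono_neutral_left) (auto simp: weight_support_def)
  then show "(\<Sum>s\<in>weight_support C l. l s) = 1"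
    using assms by (simp add: vertex_weights_def)
  show "(\<Sum>s\<in>weight_support C l. l s *\<^sub>R s) = vertex_comb C l"
    unfolding vertex_comb_def using zero finite_vertices
    by (intro sum.mono_neutral_left) (auto simp: weight_support_def)
qed

lemma card_support_pos:
  assumes "l \<in> vertex_weights C"
  shows "1 \<le> card (weight_support C l)"
proof -
  have "weight_support C l \<noteq> {}"
    using sum_support(1)[OF assms] by auto
  then show ?thesis
    using finite_support[of l] by (simp add: Suc_le_eq card_gt_0_iff)
qed

lemma vertex_comb_in_hull:
  assumes "l \<in> vertex_weights C"
  shows "vertex_comb C l \<in> convex hull (weight_support C l)"
proof -
  have "(\<Sum>s\<in>weight_support C l. l s *\<^sub>R s) \<in> convex hull (weight_support C l)"
    using sum_support(1)[OF assms] finite_support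
    by (intro convex_sum) (auto simp: weight_support_def hull_inc)
  then show ?thesis
    using sum_support(2)[OF assms] by simp
qed

lemma support_hull_subset: "convex hull (weight_support C l) \<subseteq> C"
  using vertices_subset by (intro hull_minimal convex_C) (auto simp: weight_support_def)

lemma vertex_comb_in_C:
  assumes "l \<in> vertex_weights C"
  shows "vertex_comb C l \<in> C"
  using vertex_comb_in_hull[OF assms] support_hull_subset by blast

text \<open>
  The maximum step-size is exactly the bound up to which the updated weights stay nonnegative.
  The statement covers every admissible \<open>\<xi>\<close>, not only the step-size that is finally chosen, because
  the progress estimates compare the chosen step with other admissible ones and need those points
  to lie in \<open>C\<close>.
\<close>

lemma update_weights_represents:
  assumes l: "l \<in> vertex_weights C"
    and v: "v \<in> vertices C" and a: "a \<in> weight_support C l" and z: "z \<in> weight_support C l"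
    and \<xi>: "0 \<le> \<xi>" "ereal \<xi> \<le> max_step (l a) k"
  shows "update_weights v a z \<xi> l k \<in> vertex_weights C"
    and "vertex_comb C (update_weights v a z \<xi> l k)
           = vertex_comb C l + \<xi> *\<^sub>R direction (vertex_comb C l) v a z k"
proof -
  have a': "a \<in> vertices C" "0 < l a" and z': "z \<in> vertices C"
    using a z by (auto simp: weight_support_def)
  have nonneg: "0 \<le> l s" if "s \<in> vertices C" for s
    using l that by (simp add: vertex_weights_def)
  have sum1: "(\<Sum>s\<in>vertices C. l s) = 1"
    using l by (simp add: vertex_weights_def)
  have delta: "(\<Sum>s\<in>vertices C. (if s = w then \<xi> else 0) *\<^sub>R g s) = \<xi> *\<^sub>R g w"
    if "w \<in> vertices C" for w and g :: "'a \<Rightarrow> 'b::real_vector"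
  proof -
    have "(\<Sum>s\<in>vertices C. (if s = w then \<xi> else 0) *\<^sub>R g s)
            = (\<Sum>s\<in>vertices C. if s = w then \<xi> *\<^sub>R g s else 0)"
      by (intro sum.cong refl) simp
    then show ?thesis using that finite_vertices by simp
  qed
  have linear_sum: "(\<Sum>s\<in>vertices C. update_weights v a z \<xi> l k s *\<^sub>R g s) =
    (case k of FW_Step \<Rightarrow> (1 - \<xi>) *\<^sub>R (\<Sum>s\<in>vertices C. l s *\<^sub>R g s) + \<xi> *\<^sub>R g v
      | Away_Step \<Rightarrow> (1 + \<xi>) *\<^sub>R (\<Sum>s\<in>vertices C. l s *\<^sub>R g s) - \<xi> *\<^sub>R g a
      | Pairwise_Step \<Rightarrow> (\<Sum>s\<in>vertices C. l s *\<^sub>R g s) - \<xi> *\<^sub>R g a + \<xi> *\<^sub>R g z)"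
    for g :: "'a \<Rightarrow> 'b::real_vector"
    using a' z' v
    by (cases k) (simp_all only: update_weights_eq scaleR_add_left[of _ "if _ then _ else _"]
        scaleR_diff_left[of _ "if _ then _ else _"] sum.distrib sum_subtractf delta
        scaleR_scaleR[symmetric] scaleR_sum_right[symmetric] step_kind.case)
  have la: "l a \<le> 1" using weight_le_1[OF l] a' by blast
  have "0 \<le> update_weights v a z \<xi> l k s" if s: "s \<in> vertices C" for s
  proof (cases k)
    case FW_Step
    then show ?thesis
      using nonneg[OF s] \<xi> by (simp add: update_weights_eq del: update_weights.simps)
  next
    case Away_Step
    have "\<xi> * (1 - l a) \<le> l a"
    proof (cases "l a = 1")
      case False
      then show ?thesis
        using \<xi>(2) la Away_Step by (simp add: pos_le_divide_eq)
    qed simp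
    then have "0 \<le> (1 + \<xi>) * l a - \<xi>" by (simp add: algebra_simps)
    then show ?thesis
      using nonneg[OF s] \<xi> Away_Step
      by (simp add: update_weights_eq del: update_weights.simps)
  next
    case Pairwise_Step
    then show ?thesis
      using nonneg[OF s] \<xi> by (simp add: update_weights_eq del: update_weights.simps)
  qed
  moreover have "(\<Sum>s\<in>vertices C. update_weights v a z \<xi> l k s) = 1"
    using linear_sum[of "\<lambda>_. 1::real"] sum1
    by (cases k) (simp_all del: update_weights.simps)
  ultimately show "update_weights v a z \<xi> l k \<in> vertex_weights C"
    by (simp add: vertex_weights_def)
  show "vertex_comb C (update_weights v a z \<xi> l k)
           = vertex_comb C l + \<xi> *\<^sub>R direction (vertex_comb C l) v a z k"
    unfolding vertex_comb_def linear_sum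
    by (cases k) (simp_all add: scaleR_add_left scaleR_diff_left scaleR_diff_right)
qed

text \<open>
  If \<open>y - x = \<gamma> (w - u)\<close> with \<open>w \<in> C\<close> and \<open>u\<close> in the hull of the support, then convexity gives
  \<open>f x - f y \<le> \<gamma> (\<nabla>f(x) \<bullet> u - \<nabla>f(x) \<bullet> w)\<close>, and the difference on the right is at most \<open>A - B\<close>
  by linearity. The support of the current weights is only one of the supports over
  which the vertex distance maximizes, but one is enough for an upper bound.
\<close>

lemma gap_le_vertex_distance:
  assumes l: "l \<in> vertex_weights C" and y: "y \<in> minimizers C f"
    and a: "\<And>s. s \<in> weight_support C l \<Longrightarrow> gradient f (vertex_comb C l) \<bullet> s \<le> A"
    and v: "\<And>w. w \<in> C \<Longrightarrow> B \<le> gradient f (vertex_comb C l) \<bullet> w"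
  shows "gap (vertex_comb C l) \<le> (A - B) * vertex_distance C y (vertex_comb C l)"
proof -
  define x where "x = vertex_comb C l"
  define S where "S = weight_support C l"
  define \<Gamma> where "\<Gamma> S = {\<gamma>. 0 \<le> \<gamma> \<and> (\<exists>v\<in>C. \<exists>u\<in>convex hull S. y - x = \<gamma> *\<^sub>R (v - u))}" for S
  have y': "y \<in> C" "f y = min_value C f" using y by (auto simp: minimizers_def)
  have xC: "x \<in> C" unfolding x_def by (rule vertex_comb_in_C[OF l])
  have xS: "x \<in> convex hull S" unfolding x_def S_def by (rule vertex_comb_in_hull[OF l])
  have hull: "gradient f x \<bullet> u \<le> A" if "u \<in> convex hull S" for u
  proof -
    have "convex {u. gradient f x \<bullet> u \<le> A}" by (rule convex_halfspace_le)
    then have "convex hull S \<subseteq> {u. gradient f x \<bullet> u \<le> A}"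
      using a by (intro hull_minimal) (auto simp: S_def x_def)
    then show ?thesis using that by blast
  qed
  have AB: "0 \<le> A - B" using hull[OF xS] v[OF xC, folded x_def] by linarith
  have "gap x \<le> \<gamma> * (A - B)" if "\<gamma> \<in> \<Gamma> S" for \<gamma>
  proof -
    obtain w u where wu: "w \<in> C" "u \<in> convex hull S" "y - x = \<gamma> *\<^sub>R (w - u)" and "0 \<le> \<gamma>"
      using \<open>\<gamma> \<in> \<Gamma> S\<close> unfolding \<Gamma>_def by blast
    have "gap x \<le> - (gradient f x \<bullet> (y - x))"
      using gradient_ineq[OF convex_f xC y'(1) differentiable[OF xC]] y'(2) by simp
    also have "\<dots> = \<gamma> * (gradient f x \<bullet> u - gradient f x \<bullet> w)"
      unfolding wu(3) by (simp add: algebra_simps)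
    also have "\<dots> \<le> \<gamma> * (A - B)"
      using hull[OF wu(2)] v[OF wu(1)] \<open>0 \<le> \<gamma>\<close> x_def by (intro mult_left_mono) auto
    finally show ?thesis .
  qed
  moreover have "1 \<in> \<Gamma> S" using y' xS by (auto simp: \<Gamma>_def)
  ultimately have "gap x \<le> Inf (\<Gamma> S) * (A - B)"
  proof (cases "A - B = 0")
    case False
    then have "gap x / (A - B) \<le> Inf (\<Gamma> S)"
      using AB \<open>1 \<in> \<Gamma> S\<close> \<open>\<And>\<gamma>. \<gamma> \<in> \<Gamma> S \<Longrightarrow> gap x \<le> \<gamma> * (A - B)\<close>
      by (intro cInf_greatest) (auto simp: pos_divide_le_eq)
    then show ?thesis using False AB by (simp add: pos_divide_le_eq)
  qed auto
  also have "Inf (\<Gamma> S) \<le> vertex_distance C y x"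
  proof -
    have "supports C x \<subseteq> Pow (vertices C)"
      by (auto simp: supports_def weight_support_def)
    then have "finite (supports C x)" using finite_vertices by (simp add: finite_subset)
    moreover have "S \<in> supports C x" using l by (auto simp: supports_def S_def x_def)
    ultimately show ?thesis
      unfolding vertex_distance_def \<Gamma>_def by (intro Max_ge) auto
  qed
  finally show ?thesis using AB by (simp add: x_def mult.commute mult_right_mono)
qed

end

section \<open>Error bound and linearized gap\<close>

text \<open>
  The relative decrease of the gap \<open>h\<close> that is guaranteed whenever the step-size \<open>slope / L\<close> is
  admissible.
\<close>

definition rate :: "real \<Rightarrow> real \<Rightarrow> real \<Rightarrow> real \<Rightarrow> real" where
  "rate L \<mu> \<theta> h = \<mu> powr (2 * \<theta>) * h powr (1 - 2 * \<theta>) / (8 * L)"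

text \<open>
  The estimate \<open>gap_le_vertex_distance\<close>, taken over all minimizers, yields \<open>h \<le> (A - B) (h / \<mu>)\<^sup>\<theta>\<close>. Solving for
  \<open>A - B\<close> and squaring gives \<open>(A - B)\<^sup>2 \<ge> \<mu>\<^sup>2\<^sup>\<theta> h\<^sup>2\<^sup>-\<^sup>2\<^sup>\<theta>\<close>, which is \<open>8 L\<close> times \<open>rate L \<mu> \<theta> h * h\<close>.
\<close>

lemma (in curved_polytope) gap_le_error_bound:
  assumes l: "l \<in> vertex_weights C" and eb: "error_bound C f (vertex_distance C) \<mu> \<theta>"
    and \<mu>: "\<mu> > 0"
    and a: "\<And>s. s \<in> weight_support C l \<Longrightarrow> gradient f (vertex_comb C l) \<bullet> s \<le> A"
    and v: "\<And>w. w \<in> C \<Longrightarrow> B \<le> gradient f (vertex_comb C l) \<bullet> w"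
    and pos: "0 < gap (vertex_comb C l)"
  shows "0 < A - B"
    and "8 * L * (rate L \<mu> \<theta> (gap (vertex_comb C l)) * gap (vertex_comb C l)) \<le> (A - B)\<^sup>2"
proof -
  define x where "x = vertex_comb C l"
  define h where "h = gap x"
  define D where "D = (INF y\<in>minimizers C f. vertex_distance C y x)"
  have h: "0 < h" using pos by (simp add: h_def x_def)
  have xC: "x \<in> C" unfolding x_def by (rule vertex_comb_in_C[OF l])
  have le: "h \<le> (A - B) * vertex_distance C y x" if "y \<in> minimizers C f" for y
    unfolding h_def x_def using that by (intro gap_le_vertex_distance[OF l] a v)
  obtain s where s: "s \<in> weight_support C l"
    using card_support_pos[OF l] by fastforce
  then have "s \<in> C" using vertices_subset by (auto simp: weight_support_def)
  then have "B \<le> A" using a[OF s] v by (meson order_trans)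
  moreover have "A \<noteq> B" using le h minimizers_nonempty by auto
  ultimately show AB: "0 < A - B" by simp
  have "h / (A - B) \<le> D"
    unfolding D_def using le AB minimizers_nonempty
    by (intro cINF_greatest) (auto simp: pos_divide_le_eq mult.commute)
  also have "D \<le> (if \<theta> = 0 then 1 else (h / \<mu>) powr \<theta>)"
    using eb xC by (auto simp: error_bound_def D_def h_def)
  also have "\<dots> = (h / \<mu>) powr \<theta>"
    using h \<mu> by simp
  finally have "h \<le> (A - B) * (h / \<mu>) powr \<theta>"
    using AB by (simp add: pos_divide_le_eq mult.commute)
  then have "h / (h / \<mu>) powr \<theta> \<le> A - B"
    using h \<mu> by (simp add: pos_divide_le_eq)
  then have "(h / (h / \<mu>) powr \<theta>)\<^sup>2 \<le> (A - B)\<^sup>2"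
    using h by (intro power_mono) auto
  also have "(h / (h / \<mu>) powr \<theta>)\<^sup>2 = \<mu> powr (2 * \<theta>) * (h powr (1 - 2 * \<theta>) * h)"
  proof -
    have "((h / \<mu>) powr \<theta>)\<^sup>2 = (h / \<mu>) powr (2 * \<theta>)"
      using h \<mu> by (simp add: powr_powr mult.commute flip: powr_realpow)
    also have "\<dots> = h powr (2 * \<theta>) / \<mu> powr (2 * \<theta>)"
      using h \<mu> by (simp add: powr_divide)
    finally show ?thesis
      using h \<mu> by (simp add: power_divide powr_diff power2_eq_square)
  qed
  finally show "8 * L * (rate L \<mu> \<theta> (gap (vertex_comb C l)) * gap (vertex_comb C l)) \<le> (A - B)\<^sup>2"
    using L_pos unfolding rate_def h_def x_def by (simp add: mult.assoc)
qed

section \<open>A single iteration\<close>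

text \<open>
  The choices made in one iteration, with all consequences of the selection rules available as
  facts about fixed \<open>a\<close>, \<open>z\<close>, \<open>v\<close>, \<open>k\<close> and \<open>\<eta>\<close>. Both algorithms and both step-size rules are treated
  together.
\<close>

locale frank_wolfe_iteration = curved_polytope C f L
  for C :: "'a::euclidean_space set" and f L +
  fixes alg :: variant and rule :: step_rule
    and x :: 'a and l :: "'a \<Rightarrow> real" and a z v :: 'a and k :: step_kind and \<eta> :: real
  assumes weights: "l \<in> vertex_weights C" and x_eq: "x = vertex_comb C l"
    and a: "is_arg_max (\<lambda>y. gradient f x \<bullet> y) (\<lambda>y. y \<in> weight_support C l) a"
    and z: "is_arg_min (\<lambda>y. gradient f x \<bullet> y) (\<lambda>y. y \<in> weight_support C l) z"
    and v_vertex: "v \<in> vertices C"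
    and v: "is_arg_min (\<lambda>y. gradient f x \<bullet> y) (\<lambda>y. y \<in> C) v"
    and k: "is_arg_min (\<lambda>k. gradient f x \<bullet> direction x v a z k) (\<lambda>k. k \<in> step_kinds alg) k"
    and \<eta>: "is_arg_min (step_objective f L x (direction x v a z k) rule)
          (\<lambda>\<eta>. 0 \<le> \<eta> \<and> ereal \<eta> \<le> max_step (l a) k) \<eta>"
begin

abbreviation d :: 'a where "d \<equiv> direction x v a z k"

abbreviation new_weights :: "'a \<Rightarrow> real" where "new_weights \<equiv> update_weights v a z \<eta> l k"

definition slope :: real where "slope = - (gradient f x \<bullet> d)"

definition away_gap :: real where "away_gap = gradient f x \<bullet> a - gradient f x \<bullet> v"

lemma
  shows a_support: "a \<in> weight_support C l"
    and a_max: "s \<in> weight_support C l \<Longrightarrow> gradient f x \<bullet> s \<le> gradient f x \<bullet> a"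
    and z_support: "z \<in> weight_support C l"
    and z_min: "s \<in> weight_support C l \<Longrightarrow> gradient f x \<bullet> z \<le> gradient f x \<bullet> s"
    and v_min: "w \<in> C \<Longrightarrow> gradient f x \<bullet> v \<le> gradient f x \<bullet> w"
    and k_min: "k' \<in> step_kinds alg \<Longrightarrow>
      gradient f x \<bullet> direction x v a z k \<le> gradient f x \<bullet> direction x v a z k'"
    and step_nonneg: "0 \<le> \<eta>" and step_le_max: "ereal \<eta> \<le> max_step (l a) k"
    and step_min: "0 \<le> \<xi> \<Longrightarrow> ereal \<xi> \<le> max_step (l a) k \<Longrightarrow>
      step_objective f L x d rule \<eta> \<le> step_objective f L x d rule \<xi>"
  using a z v k \<eta> by (auto simp: is_arg_max_linorder is_arg_min_linorder)

lemma x_in_C: "x \<in> C"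
  unfolding x_eq by (rule vertex_comb_in_C[OF weights])

lemma support_in_C: "s \<in> weight_support C l \<Longrightarrow> s \<in> C"
  using vertices_subset by (auto simp: weight_support_def)

lemma weight_a: "0 < l a" "l a \<le> 1"
  using a_support weight_le_1[OF weights] by (auto simp: weight_support_def)

lemma feasible:
  assumes "0 \<le> \<xi>" "ereal \<xi> \<le> max_step (l a) k"
  shows "x + \<xi> *\<^sub>R d \<in> C"
  using vertex_comb_in_C update_weights_represents[OF weights v_vertex a_support z_support assms]
  unfolding x_eq by metis

lemma new_weights: "new_weights \<in> vertex_weights C" "vertex_comb C new_weights = x + \<eta> *\<^sub>R d"
  using update_weights_represents[OF weights v_vertex a_support z_support step_nonneg step_le_max]
  unfolding x_eq by auto

lemma direction_difference: "d \<in> {p - q | p q. p \<in> C \<and> q \<in> C}"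
  using x_in_C support_in_C[OF a_support] support_in_C[OF z_support] vertices_subset v_vertex
  by (cases k) auto

text \<open>
  Extended curvature along the search ray, between any two admissible points and in either
  order: the set of differences \<open>C - C\<close> is symmetric, so \<open>- d\<close> is allowed as well.
\<close>

lemma curvature_at:
  assumes "0 \<le> \<alpha>" "ereal \<alpha> \<le> max_step (l a) k" "0 \<le> \<beta>" "ereal \<beta> \<le> max_step (l a) k"
  shows "f (x + \<beta> *\<^sub>R d) \<le> f (x + \<alpha> *\<^sub>R d)
           + (\<beta> - \<alpha>) * (gradient f (x + \<alpha> *\<^sub>R d) \<bullet> d) + L * (\<beta> - \<alpha>)\<^sup>2 / 2"
proof -
  define y e where "y = x + \<alpha> *\<^sub>R d" and "e = (if \<alpha> \<le> \<beta> then d else - d)"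
  have yC: "y \<in> C" unfolding y_def using assms by (intro feasible)
  have step: "y + \<bar>\<beta> - \<alpha>\<bar> *\<^sub>R e = x + \<beta> *\<^sub>R d"
    by (simp add: y_def e_def algebra_simps)
  have "e \<in> {p - q | p q. p \<in> C \<and> q \<in> C}"
    using direction_difference by (auto simp: e_def) (metis minus_diff_eq)
  moreover have "y + \<bar>\<beta> - \<alpha>\<bar> *\<^sub>R e \<in> C"
    unfolding step using assms by (intro feasible)
  ultimately have "f (y + \<bar>\<beta> - \<alpha>\<bar> *\<^sub>R e)
      \<le> f y + \<bar>\<beta> - \<alpha>\<bar> * (gradient f y \<bullet> e) + L * \<bar>\<beta> - \<alpha>\<bar>\<^sup>2 / 2"
    using curvature yC unfolding extended_curvature_def by (meson abs_ge_zero)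
  moreover have "\<bar>\<beta> - \<alpha>\<bar> * (gradient f y \<bullet> e) = (\<beta> - \<alpha>) * (gradient f y \<bullet> d)"
    by (simp add: e_def algebra_simps)
  ultimately show ?thesis
    unfolding step by (simp add: y_def)
qed

text \<open>
  Line search minimizes \<open>f\<close>, short-step minimizes a quadratic upper bound of \<open>f\<close>. Either way the
  value reached is at most the quadratic bound at any admissible \<open>\<xi>\<close>.
\<close>

lemma decrease:
  assumes "0 \<le> \<xi>" "ereal \<xi> \<le> max_step (l a) k"
  shows "f (x + \<eta> *\<^sub>R d) \<le> f x - \<xi> * slope + L * \<xi>\<^sup>2 / 2"
proof -
  have zero: "ereal 0 \<le> max_step (l a) k"
    using step_nonneg step_le_max order_trans ereal_less_eq(3) by blast
  have quad: "f (x + \<zeta> *\<^sub>R d) \<le> step_objective f L x d Short_Step \<zeta>"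
    if "0 \<le> \<zeta>" "ereal \<zeta> \<le> max_step (l a) k" for \<zeta>
    using curvature_at[OF order_refl zero that] by simp
  show ?thesis
  proof (cases rule)
    case Line_Search
    then show ?thesis using step_min[OF assms] quad[OF assms] by (simp add: slope_def)
  next
    case Short_Step
    then show ?thesis using step_min[OF assms] quad[OF step_nonneg step_le_max]
      by (simp add: slope_def)
  qed
qed

text \<open>
  A step below the maximum is at least as long as the unconstrained short step \<open>slope / L\<close>.
  For the short-step rule this is the location of the minimum of the quadratic. For line search,
  minimality at \<open>y = x + \<eta> d\<close> forces \<open>\<nabla>f(y) \<bullet> d \<ge> 0\<close>, and curvature read backwards from \<open>y\<close> to \<open>x\<close>
  limits the total decrease to \<open>L \<eta>\<^sup>2 / 2\<close>, while the decrease is at least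
  \<open>\<eta> slope - L \<eta>\<^sup>2 / 2\<close>. Perturbing \<open>\<eta>\<close> by a small \<open>\<epsilon>\<close> replaces derivatives in this argument.
\<close>

lemma slope_le_step:
  assumes "ereal \<eta> < max_step (l a) k"
  shows "slope \<le> L * \<eta>"
proof (rule ccontr)
  assume "\<not> slope \<le> L * \<eta>"
  then have less: "0 < (slope - L * \<eta>) / L" using L_pos by simp
  obtain \<delta> where \<delta>: "0 < \<delta>" "ereal (\<eta> + \<delta>) \<le> max_step (l a) k"
  proof (cases "max_step (l a) k")
    case (real m)
    then show ?thesis using assms that[of "m - \<eta>"] by simp
  next
    case PInf
    then show ?thesis using that[of 1] by simp
  next
    case MInf
    then show ?thesis using assms by simp
  qed
  \<comment> \<open>At most half of the violation \<open>slope - L * \<eta>\<close> is lost to the quadratic term for this \<open>\<epsilon>\<close>.\<close>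
  define \<epsilon> where "\<epsilon> = min \<delta> ((slope - L * \<eta>) / L)"
  have \<epsilon>: "0 < \<epsilon>" "0 \<le> \<eta> + \<epsilon>" using \<delta> less step_nonneg by (auto simp: \<epsilon>_def)
  have "ereal (\<eta> + \<epsilon>) \<le> ereal (\<eta> + \<delta>)" by (simp add: \<epsilon>_def)
  then have max: "ereal (\<eta> + \<epsilon>) \<le> max_step (l a) k" using \<delta>(2) by (rule order_trans)
  note better = step_min[OF \<epsilon>(2) max]
  have "slope \<le> L * \<eta> + L * \<epsilon> / 2"
  proof (cases rule)
    case Short_Step
    then have "\<epsilon> * slope \<le> \<epsilon> * (L * \<eta> + L * \<epsilon> / 2)"
      using better by (simp add: slope_def power2_eq_square field_simps)
    then show ?thesis using \<epsilon> by simp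
  next
    case Line_Search
    define y where "y = x + \<eta> *\<^sub>R d"
    have "f y \<le> f (x + (\<eta> + \<epsilon>) *\<^sub>R d)"
      using better Line_Search by (simp add: y_def)
    also have "\<dots> \<le> f y + \<epsilon> * (gradient f y \<bullet> d) + L * \<epsilon>\<^sup>2 / 2"
      using curvature_at[OF step_nonneg step_le_max \<epsilon>(2) max] by (simp add: y_def)
    finally have "0 \<le> \<epsilon> * (gradient f y \<bullet> d + L * \<epsilon> / 2)"
      by (simp add: power2_eq_square algebra_simps)
    then have uphill: "- (gradient f y \<bullet> d) \<le> L * \<epsilon> / 2"
      using \<epsilon> by (simp add: zero_le_mult_iff)
    show ?thesis
    proof (cases "\<eta> = 0")
      case True
      then show ?thesis using uphill by (simp add: slope_def y_def)
    next
      case False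
      have zero: "ereal 0 \<le> max_step (l a) k"
        using step_nonneg step_le_max order_trans ereal_less_eq(3) by blast
      have "f x \<le> f y - \<eta> * (gradient f y \<bullet> d) + L * \<eta>\<^sup>2 / 2"
        using curvature_at[OF step_nonneg step_le_max order_refl zero] by (simp add: y_def)
      moreover have "f y \<le> f x - \<eta> * slope + L * \<eta>\<^sup>2 / 2"
        using decrease[OF step_nonneg step_le_max] by (simp add: y_def)
      ultimately have "\<eta> * slope \<le> \<eta> * (- (gradient f y \<bullet> d) + L * \<eta>)"
        by (simp add: power2_eq_square algebra_simps)
      then have "slope \<le> - (gradient f y \<bullet> d) + L * \<eta>"
        using False step_nonneg by simp
      then show ?thesis using uphill by simp
    qed
  qed
  moreover have "L * \<epsilon> \<le> L * ((slope - L * \<eta>) / L)"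
    using L_pos by (intro mult_left_mono) (auto simp: \<epsilon>_def)
  ultimately show False
    using less L_pos by (simp add: zero_less_divide_iff)
qed

text \<open>
  The two candidate directions add up to a direction at least as steep as \<open>v - a\<close>: exactly
  \<open>v - a\<close> for AFW, and \<open>v - a + (z - x)\<close> for BPFW, where \<open>x\<close> lies in the hull of the support
  minimized by \<open>z\<close>. The steeper of the two therefore has at least half the slope.
\<close>

lemma away_gap_le_slope: "away_gap \<le> 2 * slope"
proof -
  have "convex {u. gradient f x \<bullet> z \<le> gradient f x \<bullet> u}"
    using convex_halfspace_ge[of "gradient f x \<bullet> z" "gradient f x"] by simp
  then have "convex hull (weight_support C l) \<subseteq> {u. gradient f x \<bullet> z \<le> gradient f x \<bullet> u}"
    using z_min by (intro hull_minimal) auto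
  then have zx: "gradient f x \<bullet> z \<le> gradient f x \<bullet> x"
    using vertex_comb_in_hull[OF weights] unfolding x_eq by auto
  show ?thesis
  proof (cases alg)
    case AFW
    then show ?thesis
      using k_min[of FW_Step] k_min[of Away_Step]
      by (simp add: slope_def away_gap_def inner_diff_right)
  next
    case BPFW
    then show ?thesis
      using k_min[of FW_Step] k_min[of Pairwise_Step] zx
      by (simp add: slope_def away_gap_def inner_diff_right)
  qed
qed

lemma gap_le_slope:
  assumes "k = FW_Step"
  shows "gap x \<le> slope"
proof -
  obtain y where y: "y \<in> C" "f y = min_value C f"
    using minimizers_nonempty by (auto simp: minimizers_def)
  have "gap x \<le> - (gradient f x \<bullet> (y - x))"
    using gradient_ineq[OF convex_f x_in_C y(1) differentiable[OF x_in_C]] y(2) by simp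
  also have "\<dots> \<le> slope"
    using v_min[OF y(1)] unfolding slope_def unfolding assms by (simp add: inner_diff_right)
  finally show ?thesis .
qed

lemma gap_nonincreasing: "gap (x + \<eta> *\<^sub>R d) \<le> gap x"
proof -
  have "ereal 0 \<le> max_step (l a) k"
    using step_nonneg step_le_max order_trans ereal_less_eq(3) by blast
  then show ?thesis using decrease[of 0] by simp
qed

text \<open>
  This makes clipping by the maximum step-size an equality, which is what empties a weight in a
  drop step and makes a Frank-Wolfe step full, even for line search.
\<close>

lemma max_step_reached:
  assumes "\<not> ereal (slope / L) \<le> max_step (l a) k"
  shows "ereal \<eta> = max_step (l a) k"
proof (rule ccontr)
  assume "ereal \<eta> \<noteq> max_step (l a) k"
  then have "slope \<le> L * \<eta>"
    using step_le_max by (intro slope_le_step) simp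
  then have "ereal (slope / L) \<le> ereal \<eta>"
    using L_pos by (simp add: pos_divide_le_eq mult.commute)
  then show False using assms step_le_max order_trans by blast
qed

lemma unclipped_decrease:
  assumes slope: "0 \<le> slope" "ereal (slope / L) \<le> max_step (l a) k" and b: "2 * L * b \<le> slope\<^sup>2"
  shows "gap (x + \<eta> *\<^sub>R d) \<le> gap x - b"
proof -
  have "f (x + \<eta> *\<^sub>R d) \<le> f x - slope\<^sup>2 / (2 * L)"
    using decrease[OF _ slope(2)] slope(1) L_pos by (simp add: power2_eq_square field_simps)
  moreover have "b \<le> slope\<^sup>2 / (2 * L)"
    using b L_pos by (simp add: pos_le_divide_eq mult.commute)
  ultimately show ?thesis by simp
qed

lemma support_subset: "weight_support C new_weights \<subseteq> insert v (weight_support C l)"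
proof
  fix s assume s: "s \<in> weight_support C new_weights"
  then have sv: "s \<in> vertices C" by (simp add: weight_support_def)
  show "s \<in> insert v (weight_support C l)"
  proof (rule ccontr)
    assume no: "s \<notin> insert v (weight_support C l)"
    then have "l s = 0" using sv weights by (force simp: weight_support_def vertex_weights_def)
    moreover have "s \<noteq> v" "s \<noteq> a" "s \<noteq> z" using no a_support z_support by auto
    ultimately have "new_weights s = 0"
      by (cases k) (simp_all add: update_weights_eq del: update_weights.simps)
    then show False using s by (simp add: weight_support_def)
  qed
qed

lemma card_support_le: "card (weight_support C new_weights) \<le> card (weight_support C l) + 1"
proof -
  have "card (weight_support C new_weights) \<le> card (insert v (weight_support C l))"
    using finite_support support_subset by (intro card_mono) auto
  also have "\<dots> \<le> card (weight_support C l) + 1"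
    using finite_support[of l] by (simp add: card_insert_if)
  finally show ?thesis .
qed

text \<open>
  At the maximum step-size the weight of \<open>a\<close> becomes zero and no vertex enters the support. A
  positive slope excludes the zero directions (\<open>l a = 1\<close> for away steps, \<open>a = z\<close> for pairwise steps),
  for which nothing is dropped.
\<close>

lemma drop_step:
  assumes "0 < slope" "k \<noteq> FW_Step" "ereal \<eta> = max_step (l a) k"
  shows "card (weight_support C new_weights) + 1 \<le> card (weight_support C l)"
proof -
  have "weight_support C new_weights \<subseteq> weight_support C l - {a}"
  proof
    fix s assume s: "s \<in> weight_support C new_weights"
    then have pos: "s \<in> vertices C" "0 < new_weights s" by (auto simp: weight_support_def)
    have nonneg: "0 \<le> l s" using pos weights by (simp add: vertex_weights_def)
    have "s \<noteq> a \<and> 0 < l s"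
    proof (cases k)
      case Away_Step
      then have "l a \<noteq> 1" using assms(3) by auto
      then have "\<eta> * (1 - l a) = l a" using assms(3) Away_Step by simp
      then have "(1 + \<eta>) * l a - \<eta> = 0" by (simp add: algebra_simps)
      then have "s \<noteq> a" using pos(2) Away_Step by auto
      then have "0 < (1 + \<eta>) * l s" using pos(2) Away_Step by simp
      then show ?thesis using \<open>s \<noteq> a\<close> step_nonneg by (simp add: zero_less_mult_iff)
    next
      case Pairwise_Step
      have "a \<noteq> z" using assms(1) unfolding slope_def unfolding Pairwise_Step by auto
      moreover have "\<eta> = l a" using assms(3) Pairwise_Step by simp
      ultimately show ?thesis
        using pos(2) Pairwise_Step nonneg z_support
        by (auto simp: weight_support_def split: if_splits)
    qed (use assms(2) in simp)
    then show "s \<in> weight_support C l - {a}"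
      using pos by (simp add: weight_support_def)
  qed
  then have "card (weight_support C new_weights) \<le> card (weight_support C l - {a})"
    using finite_support by (intro card_mono) auto
  moreover have "0 < card (weight_support C l)"
    using card_support_pos[OF weights] by simp
  ultimately show ?thesis using a_support by simp
qed

context
  fixes \<mu> \<theta> :: real
  assumes mu: "\<mu> > 0" and eb: "error_bound C f (vertex_distance C) \<mu> \<theta>"
begin

lemma away_gap_bound:
  assumes "0 < gap x"
  shows "0 < away_gap" "8 * L * (rate L \<mu> \<theta> (gap x) * gap x) \<le> away_gap\<^sup>2"
  using gap_le_error_bound[OF weights eb mu, of "gradient f x \<bullet> a" "gradient f x \<bullet> v"]
    a_max v_min assms
  unfolding away_gap_def x_eq[symmetric] by auto

text \<open>
  The central dichotomy. If \<open>slope / L\<close> is admissible, the decrease is at least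
  \<open>slope\<^sup>2 / (2 L) \<ge> away_gap\<^sup>2 / (8 L)\<close>, hence controlled by the rate. Otherwise the step is clipped: a
  clipped Frank-Wolfe step has length one and \<open>slope > L\<close>, which at least halves the gap, and any other
  clipped step removes a vertex from the support.
\<close>

lemma step_progress:
  "gap (x + \<eta> *\<^sub>R d) \<le> (1 - min (rate L \<mu> \<theta> (gap x)) (1/2)) * gap x \<and>
     card (weight_support C new_weights) \<le> card (weight_support C l) + 1 \<or>
   gap (x + \<eta> *\<^sub>R d) \<le> gap x \<and>
     card (weight_support C new_weights) + 1 \<le> card (weight_support C l)"
proof (cases "gap x = 0")
  case True
  then show ?thesis using gap_nonincreasing card_support_le by simp
next
  case False
  then have pos: "0 < gap x" using min_value_le[OF x_in_C] by simp
  note away = away_gap_bound[OF pos]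
  have slope: "0 < slope" using away_gap_le_slope away(1) by simp
  show ?thesis
  proof (cases "ereal (slope / L) \<le> max_step (l a) k")
    case True
    have "away_gap\<^sup>2 \<le> (2 * slope)\<^sup>2"
      using away_gap_le_slope away(1) by (intro power_mono) auto
    with away(2) have "8 * L * (rate L \<mu> \<theta> (gap x) * gap x) \<le> (2 * slope)\<^sup>2"
      by (rule order_trans)
    then have "2 * L * (rate L \<mu> \<theta> (gap x) * gap x) \<le> slope\<^sup>2"
      by (simp add: power_mult_distrib mult_ac)
    then have "gap (x + \<eta> *\<^sub>R d) \<le> gap x - rate L \<mu> \<theta> (gap x) * gap x"
      using slope True by (intro unclipped_decrease) auto
    also have "\<dots> = (1 - rate L \<mu> \<theta> (gap x)) * gap x"
      by (simp add: algebra_simps)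
    also have "\<dots> \<le> (1 - min (rate L \<mu> \<theta> (gap x)) (1/2)) * gap x"
      using pos by (intro mult_right_mono) auto
    finally show ?thesis using card_support_le by blast
  next
    case False
    then have max: "ereal \<eta> = max_step (l a) k" by (rule max_step_reached)
    show ?thesis
    proof (cases "k = FW_Step")
      case True
      have "L < slope" using False True L_pos by (simp add: pos_divide_le_eq one_ereal_def)
      then have "gap (x + \<eta> *\<^sub>R d) \<le> gap x - slope / 2"
        using decrease[of 1] True by (simp add: one_ereal_def)
      also have "\<dots> \<le> (1 - 1/2) * gap x"
        using gap_le_slope[OF True] by simp
      also have "\<dots> \<le> (1 - min (rate L \<mu> \<theta> (gap x)) (1/2)) * gap x"
        using pos by (intro mult_right_mono) auto
      finally show ?thesis using card_support_le by blast
    next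
      case False
      then show ?thesis using drop_step[OF slope False max] gap_nonincreasing by blast
    qed
  qed
qed

text \<open>
  At a vertex carrying the whole weight, away and pairwise directions vanish, so the step is a
  Frank-Wolfe step whose slope is the entire linearized gap rather than half of it. With a rate
  above \<open>1/2\<close>, a step-size \<open>slope / L \<le> 1\<close> would make the gap decrease by more than twice its
  value, which is impossible. Thus the step has length one and ends at the vertex \<open>v\<close>.
\<close>

lemma full_step_from_vertex:
  assumes card: "card (weight_support C l) = 1" and large: "1/2 < rate L \<mu> \<theta> (gap x)"
  shows "card (weight_support C new_weights) = 1"
proof -
  have "gap x \<noteq> 0" using large by (auto simp: rate_def)
  then have pos: "0 < gap x" using min_value_le[OF x_in_C] by simp
  note away = away_gap_bound[OF pos]
  have slope: "0 < slope" using away_gap_le_slope away(1) by simp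
  have single: "weight_support C l = {a}"
    using card a_support by (metis card_1_singletonE singletonD)
  then have "z = a" using z_support by simp
  have "x = a" "l a = 1"
    using sum_support[OF weights] single x_eq by auto
  have FW: "k = FW_Step"
    using slope \<open>x = a\<close> \<open>z = a\<close> unfolding slope_def by (cases k) auto
  then have "slope = away_gap"
    using \<open>x = a\<close> unfolding slope_def away_gap_def by (simp add: inner_diff_right)
  have "L < slope"
  proof (rule ccontr)
    assume no: "\<not> L < slope"
    have "8 * L * ((1/2) * gap x) \<le> 8 * L * (rate L \<mu> \<theta> (gap x) * gap x)"
      using pos large L_pos by (intro mult_left_mono mult_right_mono) auto
    also note away(2)
    finally have "2 * L * (2 * gap x) \<le> slope\<^sup>2"
      using \<open>slope = away_gap\<close> by (simp only: mult_ac)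
    then have "gap (x + \<eta> *\<^sub>R d) \<le> gap x - 2 * gap x"
      using no slope L_pos FW by (intro unclipped_decrease) (auto simp: one_ereal_def)
    moreover have "0 \<le> gap (x + \<eta> *\<^sub>R d)"
      using min_value_le[OF feasible[OF step_nonneg step_le_max]] by simp
    ultimately show False using pos by simp
  qed
  have "\<eta> = 1"
  proof (rule ccontr)
    assume "\<eta> \<noteq> 1"
    then have "\<eta> < 1" using step_le_max FW by (simp add: one_ereal_def)
    then have "slope \<le> L * \<eta>" using FW by (intro slope_le_step) (simp add: one_ereal_def)
    moreover have "L * \<eta> < L" using \<open>\<eta> < 1\<close> L_pos by simp
    ultimately show False using \<open>L < slope\<close> by simp
  qed
  then have "weight_support C new_weights = {v}"
    using v_vertex FW by (auto simp: weight_support_def split: if_splits)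
  then show ?thesis by simp
qed

end

end

context curved_polytope
begin

lemma fw_step_progress:
  assumes l: "l \<in> vertex_weights C" and x: "x = vertex_comb C l"
    and mu: "\<mu> > 0" and eb: "error_bound C f (vertex_distance C) \<mu> \<theta>"
    and step: "fw_step alg rule C f L x l x' l'"
  shows "l' \<in> vertex_weights C" "x' = vertex_comb C l'"
    and "gap x' \<le> (1 - min (rate L \<mu> \<theta> (gap x)) (1/2)) * gap x \<and>
           card (weight_support C l') \<le> card (weight_support C l) + 1 \<or>
         gap x' \<le> gap x \<and> card (weight_support C l') + 1 \<le> card (weight_support C l)"
    and "card (weight_support C l) = 1 \<Longrightarrow> 1/2 < rate L \<mu> \<theta> (gap x) \<Longrightarrow>
           card (weight_support C l') = 1"
proof -
  obtain a z v k \<eta> where it: "frank_wolfe_iteration C f L alg rule x l a z v k \<eta>"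
    and x': "x' = x + \<eta> *\<^sub>R direction x v a z k"
    and l': "\<And>s. s \<in> vertices C \<Longrightarrow> l' s = update_weights v a z \<eta> l k s"
    using step l x unfolding fw_step_def frank_wolfe_iteration_def
      frank_wolfe_iteration_axioms_def using curved_polytope_axioms by blast
  interpret frank_wolfe_iteration C f L alg rule x l a z v k \<eta> by (rule it)
  have cong: "l' \<in> vertex_weights C \<longleftrightarrow> new_weights \<in> vertex_weights C"
    "vertex_comb C l' = vertex_comb C new_weights"
    "weight_support C l' = weight_support C new_weights"
    using l' by (intro vertex_weights_cong; blast)+
  show "l' \<in> vertex_weights C" "x' = vertex_comb C l'"
    using cong new_weights x' by simp_all
  show "gap x' \<le> (1 - min (rate L \<mu> \<theta> (gap x)) (1/2)) * gap x \<and>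
           card (weight_support C l') \<le> card (weight_support C l) + 1 \<or>
         gap x' \<le> gap x \<and> card (weight_support C l') + 1 \<le> card (weight_support C l)"
    using step_progress[OF mu eb] unfolding cong(3) x' .
  show "card (weight_support C l') = 1"
    if "card (weight_support C l) = 1" "1/2 < rate L \<mu> \<theta> (gap x)"
    using full_step_from_vertex[OF mu eb that] unfolding cong(3) .
qed

end

section \<open>Counting productive steps\<close>

text \<open>
  Here \<open>h\<close> stands for the gap, \<open>c\<close> for the size of the support and \<open>B k\<close> for a bound on the gap after
  \<open>k\<close> productive steps. Supports have at least one element and grow only in productive steps, by at
  most one, so each shrinking step is paid for by an earlier productive one. The invariant is
  \<open>n + c n \<le> 2 k + 1\<close>, where \<open>k\<close> counts the productive steps so far; it holds initially because the
  support starts as a single vertex.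
\<close>

lemma half_of_steps_productive:
  fixes h B :: "nat \<Rightarrow> real" and c :: "nat \<Rightarrow> nat"
  assumes c_pos: "\<And>n. 1 \<le> c n" and c0: "c 0 = 1" and h0: "h 0 \<le> B 0" and B: "decseq B"
    and step: "\<And>n. productive n \<and> c (Suc n) \<le> c n + 1 \<or> h (Suc n) \<le> h n \<and> c (Suc n) + 1 \<le> c n"
    and productive: "\<And>n k. productive n \<Longrightarrow> h n \<le> B k \<Longrightarrow> h (Suc n) \<le> B (Suc k)"
  shows "h n \<le> B (nat \<lceil>real n / 2\<rceil>)"
proof -
  have "\<exists>k. n + c n \<le> 2 * k + 1 \<and> h n \<le> B k"
  proof (induction n)
    case 0
    then show ?case using c0 h0 by (intro exI[of _ 0]) simp
  next
    case (Suc n)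
    then obtain k where k: "n + c n \<le> 2 * k + 1" "h n \<le> B k" by blast
    from step[of n] show ?case
    proof
      assume "productive n \<and> c (Suc n) \<le> c n + 1"
      then show ?thesis using k productive by (intro exI[of _ "Suc k"]) auto
    next
      assume "h (Suc n) \<le> h n \<and> c (Suc n) + 1 \<le> c n"
      then show ?thesis using k by (intro exI[of _ k]) auto
    qed
  qed
  then obtain k where k: "n + c n \<le> 2 * k + 1" "h n \<le> B k" by blast
  have "n \<le> 2 * k" using k(1) c_pos[of n] by simp
  then have "real n / 2 \<le> real k" by simp
  then have "nat \<lceil>real n / 2\<rceil> \<le> k" by (simp add: nat_le_iff ceiling_le_iff)
  then show ?thesis using k(2) decseqD[OF B] order_trans by blast
qed

section \<open>Recursions for the gap\<close>

text \<open>
  In terms of \<open>y powr (- e)\<close> the contraction becomes additive: with \<open>u = q * y powr e\<close>, the inequality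
  \<open>(1 - u) powr (- e) \<ge> 1 + e u\<close> says that this quantity grows by at least \<open>e q\<close> in each step.
\<close>

lemma sublinear_step:
  fixes e q D y y' :: real
  assumes e: "0 < e" and q: "0 \<le> q" and D: "0 < D"
    and y: "0 \<le> y" "y \<le> D powr (- (1 / e))" and small: "q * y powr e \<le> 1/2"
    and y': "y' \<le> (1 - q * y powr e) * y"
  shows "y' \<le> (D + e * q) powr (- (1 / e))"
proof (cases "y' \<le> 0")
  case True
  then show ?thesis by (rule order_trans) simp
next
  case False
  define u where "u = q * y powr e"
  have u: "0 \<le> u" "u \<le> 1/2" using q small by (auto simp: u_def)
  have "y \<noteq> 0" using False y' by auto
  then have ypos: "0 < y" using y by simp
  have "D = (D powr (- (1 / e))) powr (- e)"
    using D e by (simp add: powr_powr)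
  also have "\<dots> \<le> y powr (- e)"
    using ypos y(2) e by (intro powr_mono2') auto
  finally have "D + e * q \<le> y powr (- e) + e * q" by simp
  also have "\<dots> = y powr (- e) * (1 + e * u)"
    using ypos by (simp add: u_def powr_minus field_simps)
  also have "\<dots> \<le> y powr (- e) * (1 - u) powr (- e)"
  proof (rule mult_left_mono)
    have "ln (1 - u) \<le> - u" using u ln_le_minus_one[of "1 - u"] by simp
    then have "e * u \<le> - e * ln (1 - u)"
      using mult_left_mono[of "ln (1 - u)" "- u" e] e by simp
    moreover have "1 + - e * ln (1 - u) \<le> exp (- e * ln (1 - u))" by (rule exp_ge_add_one_self)
    ultimately show "1 + e * u \<le> (1 - u) powr (- e)"
      using u by (simp add: powr_def)
  qed simp
  also have "\<dots> = ((1 - u) * y) powr (- e)"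
    using u ypos by (simp add: powr_mult)
  also have "\<dots> \<le> y' powr (- e)"
    using False y' e by (intro powr_mono2') (auto simp: u_def)
  finally have "(y' powr (- e)) powr (- (1 / e)) \<le> (D + e * q) powr (- (1 / e))"
    using D e q by (intro powr_mono2') (auto intro!: add_pos_nonneg)
  then show ?thesis using False e by (simp add: powr_powr)
qed

text \<open>
  The rate is at most \<open>1/2\<close> once \<open>h\<close> is below the threshold \<open>b\<close> of the proof; geometric decay reaches
  this threshold because the exponent \<open>1 - 2 \<theta>\<close> is positive.
\<close>

lemma rate_below_half_reached:
  fixes h :: "nat \<Rightarrow> real"
  assumes L: "0 < L" and \<theta>: "\<theta> < 1/2" and mu: "0 < \<mu>"
    and h: "\<And>t. 0 \<le> h t" "\<And>t. h t \<le> h 0 / 2 ^ t"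
  shows "\<exists>t. rate L \<mu> \<theta> (h t) \<le> 1/2"
proof -
  define e where "e = 1 - 2 * \<theta>"
  have e: "0 < e" using \<theta> by (simp add: e_def)
  define b where "b = (4 * L / \<mu> powr (2 * \<theta>)) powr (1 / e)"
  have b: "0 < b" using L mu by (simp add: b_def)
  obtain t where "h 0 / b < 2 ^ t" using real_arch_pow[of 2] by auto
  then have "h 0 / 2 ^ t \<le> b" using b by (simp add: field_simps)
  then have "h t powr e \<le> b powr e" using h[of t] e by (intro powr_mono2) auto
  also have "\<dots> = 4 * L / \<mu> powr (2 * \<theta>)"
    using e L mu by (simp add: b_def powr_powr)
  finally have "rate L \<mu> \<theta> (h t) \<le> 1/2"
    using L mu by (simp add: rate_def e_def field_simps)
  then show ?thesis ..
qed

section \<open>Convergence rates\<close>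

theorem theorem3p6:
  fixes C :: "(real ^ 'n) set" and f :: "real ^ 'n \<Rightarrow> real"
    and L \<mu> \<theta> :: real
    and alg :: variant and rule :: step_rule
    and x :: "nat \<Rightarrow> real ^ 'n" and l :: "nat \<Rightarrow> real ^ 'n \<Rightarrow> real"
  assumes "polytope C" and "C \<noteq> {}"
    and "convex_on C f"
    and "\<exists>U. open U \<and> C \<subseteq> U \<and> f differentiable_on U"
    and "L > 0" and "extended_curvature C f L"
    and "\<mu> > 0" and "\<theta> \<in> {0..1/2}"
    and "error_bound C f (vertex_distance C) \<mu> \<theta>"
    and "fw_run alg rule C f L x l"
  shows "(\<theta> = 1/2 \<longrightarrow>
           (\<forall>t. f (x t) - min_value C f
                  \<le> (f (x 0) - min_value C f) * (1 - min (\<mu> / (8 * L)) (1/2)) ^ nat \<lceil>real t / 2\<rceil>)) \<and>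
         (\<theta> < 1/2 \<longrightarrow>
           (\<exists>t0 t1.
              \<mu> powr (2 * \<theta>) * (f (x t0) - min_value C f) powr (1 - 2 * \<theta>) / (8 * L) \<le> 1/2 \<and>
              (\<forall>t<t0. \<not> \<mu> powr (2 * \<theta>) * (f (x t) - min_value C f) powr (1 - 2 * \<theta>) / (8 * L) \<le> 1/2) \<and>
              t1 = card (weight_support C (l t0)) + t0 - 1 \<and>
              (\<forall>t\<le>t0. f (x t) - min_value C f \<le> (f (x 0) - min_value C f) / 2 ^ nat \<lceil>real t / 2\<rceil>) \<and>
              (\<forall>t. t0 < t \<and> t \<le> t1 \<longrightarrow> f (x t) - min_value C f \<le> f (x t0) - min_value C f) \<and>
              (\<forall>t>t1. f (x t) - min_value C f \<le>
                 (if f (x t1) - min_value C f = 0 then 0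
                  else ((f (x t1) - min_value C f) powr (2 * \<theta> - 1)
                        + (1 - 2 * \<theta>) * \<mu> powr (2 * \<theta>) / (8 * L) * \<lceil>(real t - real t1) / 2\<rceil>)
                       powr (1 / (2 * \<theta> - 1))))))"
proof -
  interpret curved_polytope C f L
  proof
    fix p assume "p \<in> C"
    then show "f differentiable at p"
      using assms(4) by (metis at_within_open differentiable_on_def subsetD)
  qed (use assms in auto)
  define h where "h t = gap (x t)" for t
  define c where "c t = card (weight_support C (l t))" for t
  note mu = \<open>\<mu> > 0\<close> and eb = \<open>error_bound C f (vertex_distance C) \<mu> \<theta>\<close>
  have step: "fw_step alg rule C f L (x t) (l t) (x (Suc t)) (l (Suc t))" for t
    using \<open>fw_run alg rule C f L x l\<close> by (simp add: fw_run_def)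
  have inv: "l t \<in> vertex_weights C \<and> x t = vertex_comb C (l t)" for t
  proof (induction t)
    case 0
    then show ?case using \<open>fw_run alg rule C f L x l\<close> by (simp add: fw_run_def)
  next
    case (Suc t)
    then show ?case using fw_step_progress(1,2)[OF _ _ mu eb step] by blast
  qed
  have c0: "c 0 = 1" using \<open>fw_run alg rule C f L x l\<close> by (simp add: fw_run_def c_def)
  have c_pos: "1 \<le> c t" for t
    unfolding c_def using inv by (intro card_support_pos) blast
  have h_nonneg: "0 \<le> h t" for t
    using min_value_le[OF vertex_comb_in_C] inv[of t] by (simp add: h_def)
  define productive where
    "productive t \<longleftrightarrow> h (Suc t) \<le> (1 - min (rate L \<mu> \<theta> (h t)) (1/2)) * h t" for t
  have progress: "productive t \<and> c (Suc t) \<le> c t + 1 \<or> h (Suc t) \<le> h t \<and> c (Suc t) + 1 \<le> c t" for t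
    using fw_step_progress(3)[OF _ _ mu eb step] inv[of t]
    unfolding productive_def h_def c_def by blast
  have rate_nonneg: "0 \<le> rate L \<mu> \<theta> r" for r
    using L_pos by (simp add: rate_def)
  have h_Suc: "h (Suc t) \<le> h t" for t
  proof (cases "productive t")
    case True
    then have "h (Suc t) \<le> (1 - min (rate L \<mu> \<theta> (h t)) (1/2)) * h t" by (simp add: productive_def)
    also have "\<dots> \<le> h t"
      using rate_nonneg[of "h t"] h_nonneg[of t] by (intro mult_left_le_one_le) auto
    finally show ?thesis .
  qed (use progress in blast)
  then have h_mono: "h t \<le> h s" if "s \<le> t" for s t
    using lift_Suc_antimono_le[of h] that by blast
  show ?thesis
    unfolding h_def[symmetric] c_def[symmetric] rate_def[symmetric]
  proof (intro conjI impI)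
    assume half: "\<theta> = 1/2"
    define \<rho> where "\<rho> = 1 - min (\<mu> / (8 * L)) (1/2)"
    have \<rho>: "0 \<le> \<rho>" "\<rho> \<le> 1" using mu L_pos by (auto simp: \<rho>_def)
    have "h t \<le> h 0 * \<rho> ^ nat \<lceil>real t / 2\<rceil>" for t
    proof (rule half_of_steps_productive[OF c_pos c0 _ _ progress])
      show "decseq (\<lambda>k. h 0 * \<rho> ^ k)"
        using \<rho> h_nonneg by (intro decseq_SucI mult_left_mono power_decreasing) auto
      fix n k assume n: "productive n" "h n \<le> h 0 * \<rho> ^ k"
      have "h (Suc n) \<le> \<rho> * h n"
      proof (cases "h n = 0")
        case True
        then show ?thesis using h_Suc[of n] by simp
      next
        case False
        then have "rate L \<mu> \<theta> (h n) = \<mu> / (8 * L)"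
          using mu h_nonneg[of n] unfolding half by (simp add: rate_def)
        then show ?thesis using n(1) by (simp add: productive_def \<rho>_def)
      qed
      also have "\<dots> \<le> \<rho> * (h 0 * \<rho> ^ k)" using n(2) \<rho> by (intro mult_left_mono) auto
      finally show "h (Suc n) \<le> h 0 * \<rho> ^ Suc k" by (simp add: mult.left_commute)
    qed simp
    then show "\<forall>t. h t \<le> h 0 * (1 - min (\<mu> / (8 * L)) (1/2)) ^ nat \<lceil>real t / 2\<rceil>"
      by (simp add: \<rho>_def)
  next
    assume less: "\<theta> < 1/2"
    define e where "e = 1 - 2 * \<theta>"
    have e: "0 < e" "2 * \<theta> - 1 = - e" using less by (auto simp: e_def)
    \<comment> \<open>While the rate exceeds one half, the iterates move from vertex to vertex by full steps.\<close>
    have burn_in: "h t \<le> h 0 / 2 ^ t \<and> c t = 1" if "\<And>s. s < t \<Longrightarrow> \<not> rate L \<mu> \<theta> (h s) \<le> 1/2" for t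
      using that
    proof (induction t)
      case 0
      then show ?case using c0 by simp
    next
      case (Suc t)
      then have IH: "h t \<le> h 0 / 2 ^ t" "c t = 1" and large: "1/2 < rate L \<mu> \<theta> (h t)"
        by (auto simp: not_le)
      have "productive t" using progress[of t] IH(2) c_pos[of "Suc t"] by auto
      then have "h (Suc t) \<le> h t / 2" using large by (simp add: productive_def min_def)
      then have "h (Suc t) \<le> h 0 / 2 ^ Suc t" using IH(1) by simp
      moreover have "c (Suc t) = 1"
        using fw_step_progress(4)[OF _ _ mu eb step] inv[of t] IH(2) large
        unfolding h_def c_def by blast
      ultimately show ?case by simp
    qed
    have "\<exists>t. rate L \<mu> \<theta> (h t) \<le> 1/2"
    proof (rule ccontr)
      assume no: "\<not> ?thesis"
      then have "h t \<le> h 0 / 2 ^ t" for t using burn_in by blast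
      then show False
        using rate_below_half_reached[of L \<theta> \<mu> h] L_pos less mu h_nonneg no by blast
    qed
    then obtain t0 where t0: "rate L \<mu> \<theta> (h t0) \<le> 1/2"
      and before: "\<forall>t<t0. \<not> rate L \<mu> \<theta> (h t) \<le> 1/2"
      using exists_least_iff[of "\<lambda>t. rate L \<mu> \<theta> (h t) \<le> 1/2"] by blast
    have c_t0: "c t0 = 1" using burn_in before by blast
    have early: "h t \<le> h 0 / 2 ^ nat \<lceil>real t / 2\<rceil>" if "t \<le> t0" for t
    proof -
      have "nat \<lceil>real t / 2\<rceil> \<le> t" by (simp add: nat_le_iff ceiling_le_iff)
      then have "h 0 / 2 ^ t \<le> h 0 / 2 ^ nat \<lceil>real t / 2\<rceil>"
        using h_nonneg by (intro divide_left_mono power_increasing) auto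
      moreover have "h t \<le> h 0 / 2 ^ t" using burn_in before that by auto
      ultimately show ?thesis by simp
    qed
    define q where "q = \<mu> powr (2 * \<theta>) / (8 * L)"
    have q: "0 \<le> q" using L_pos by (simp add: q_def)
    have rate_eq: "rate L \<mu> \<theta> r = q * r powr e" for r
      by (simp add: rate_def q_def e_def)
    define B where "B k = (h t0 powr (- e) + real k * (e * q)) powr (- (1 / e))" for k
    have late: "h (t0 + n) \<le> B (nat \<lceil>real n / 2\<rceil>)" if nz: "h t0 \<noteq> 0" for n
    proof (rule half_of_steps_productive[where c = "\<lambda>n. c (t0 + n)" and h = "\<lambda>n. h (t0 + n)"
          and productive = "\<lambda>n. productive (t0 + n)"])
      have pos: "0 < h t0 powr (- e) + real k * (e * q)" for k
        using nz e q by (intro add_pos_nonneg) auto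
      have B0: "B 0 = h t0"
        using nz h_nonneg[of t0] e by (simp add: B_def powr_powr)
      then show "h (t0 + 0) \<le> B 0" by simp
      show "decseq B"
        unfolding B_def using e q pos
        by (intro decseq_SucI powr_mono2' add_left_mono mult_right_mono) auto
      fix n k assume n: "productive (t0 + n)" "h (t0 + n) \<le> B k"
      have "h (t0 + n) powr e \<le> h t0 powr e"
        using h_mono[of t0 "t0 + n"] h_nonneg e by (intro powr_mono2) auto
      then have small: "q * h (t0 + n) powr e \<le> 1/2"
        using t0 q mult_left_mono[of _ _ q] unfolding rate_eq by (meson order_trans)
      have "h (t0 + Suc n) \<le> (h t0 powr (- e) + real k * (e * q) + e * q) powr (- (1 / e))"
        using n small e q pos h_nonneg unfolding productive_def rate_eq B_def
        by (intro sublinear_step[where y = "h (t0 + n)"]) auto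
      then show "h (t0 + Suc n) \<le> B (Suc k)"
        by (simp add: B_def algebra_simps)
    qed (use c_pos c_t0 progress in auto)
    show "\<exists>t0 t1. rate L \<mu> \<theta> (h t0) \<le> 1/2 \<and> (\<forall>t<t0. \<not> rate L \<mu> \<theta> (h t) \<le> 1/2) \<and>
        t1 = c t0 + t0 - 1 \<and> (\<forall>t\<le>t0. h t \<le> h 0 / 2 ^ nat \<lceil>real t / 2\<rceil>) \<and>
        (\<forall>t. t0 < t \<and> t \<le> t1 \<longrightarrow> h t \<le> h t0) \<and>
        (\<forall>t>t1. h t \<le> (if h t1 = 0 then 0 else (h t1 powr (2 * \<theta> - 1)
          + (1 - 2 * \<theta>) * \<mu> powr (2 * \<theta>) / (8 * L) * \<lceil>(real t - real t1) / 2\<rceil>)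
            powr (1 / (2 * \<theta> - 1))))"
    \<comment> \<open>A single-vertex support at time \<open>t0\<close> means \<open>t1 = t0\<close>, so the intermediate phase is empty.\<close>
    proof (rule exI[of _ t0], rule exI[of _ t0], intro conjI)
      show "\<forall>t>t0. h t \<le> (if h t0 = 0 then 0 else (h t0 powr (2 * \<theta> - 1)
          + (1 - 2 * \<theta>) * \<mu> powr (2 * \<theta>) / (8 * L) * \<lceil>(real t - real t0) / 2\<rceil>)
            powr (1 / (2 * \<theta> - 1)))"
      proof (intro allI impI)
        fix t assume "t0 < t"
        define n where "n = t - t0"
        have n: "t = t0 + n" using \<open>t0 < t\<close> by (simp add: n_def)
        have ceil: "real (nat \<lceil>real n / 2\<rceil>) = of_int \<lceil>(real t - real t0) / 2\<rceil>"
          by (simp add: n)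
        have exponent: "1 / - e = - (1 / e)"
          by simp
        have coefficient: "(1 - 2 * \<theta>) * \<mu> powr (2 * \<theta>) / (8 * L) * r = r * (e * q)" for r
          by (simp add: e_def q_def)
        have "h t \<le> 0" if "h t0 = 0"
          using h_mono[of t0 t] \<open>t0 < t\<close> that by simp
        moreover have "h t \<le> (h t0 powr (2 * \<theta> - 1)
          + (1 - 2 * \<theta>) * \<mu> powr (2 * \<theta>) / (8 * L) * \<lceil>(real t - real t0) / 2\<rceil>)
            powr (1 / (2 * \<theta> - 1))" if "h t0 \<noteq> 0"
          using late[OF that, of n] unfolding B_def ceil n[symmetric] e(2) exponent coefficient .
        ultimately show "h t \<le> (if h t0 = 0 then 0 else (h t0 powr (2 * \<theta> - 1)
          + (1 - 2 * \<theta>) * \<mu> powr (2 * \<theta>) / (8 * L) * \<lceil>(real t - real t0) / 2\<rceil>)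
            powr (1 / (2 * \<theta> - 1)))" by simp
      qed
    qed (use t0 before c_t0 early in auto)
  qed
qed

end
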